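(* Let $A\in\mathbb{R}^{n\times n}$, $B\in\mathbb{R}^{n\times m}$, $C\in\mathbb{R}^{m\times n}$ with nonzero rows $C_1^T,\dots,C_m^T$, and let $\phi:\mathbb{R}^m\to\mathbb{R}^m$ be locally Lipschitz with $\phi(0)=0$. Consider the nominal system $\dot x = Ax+B\phi(Cx)$. Let $\underline{y},\overline{y}\in\mathbb{R}^m$ satisfy $\underline{y}_i<0<\overline{y}_i$ for all $i$, and let $\mathcal{P}=\{x\in\mathbb{R}^n : \underline{y}\le Cx\le\overline{y}\}$ (componentwise inequalities). Let $W(x)=x^TPx$ with $P\in\mathbb{R}^{n\times n}$ symmetric positive definite, and suppose that $\dot W(x)<0$ for every $x\in\mathcal{P}\setminus\{0\}$. Define $$W^{\min}=\min\{W(x) : x\in\mathbb{R}^n,\ C_i^Tx=\underline{y}_i \text{ or } C_i^Tx=\overline{y}_i \text{ for some } i\},\qquad \Omega=\{x\in\mathcal{P} : W(x)\le W^{\min}\}.$$ Then for any fault-cleared state $x(t_c)\in\Omega$, the trajectory of the nominal system starting from $x(t_c)$ at time $t_c$ stays in $\Omega$ for all $t\ge t_c$ and converges to the origin as $t\to\infty$.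
   Context: $\dot W(x)$ denotes the derivative of $W$ along trajectories of the nominal system, i.e. $\dot W(x)=2x^TP(Ax+B\phi(Cx))$. The nominal system is the system after the disturbance has been cleared at time $t_c$, with coordinates chosen so that its equilibrium is the origin. *)

theory Defs
  imports "HOL-Analysis.Analysis"
begin

definition nominal_field ::
  "real^'n^'n \<Rightarrow> real^'m^'n \<Rightarrow> real^'n^'m \<Rightarrow> (real^'m \<Rightarrow> real^'m) \<Rightarrow> real^'n \<Rightarrow> real^'n" where
  "nominal_field A B C \<phi> x = A *v x + B *v \<phi> (C *v x)"

(* The derivative is taken within J, hence one-sided at an endpoint of J that belongs to J. *)
definition nominal_solution_on ::
  "real^'n^'n \<Rightarrow> real^'m^'n \<Rightarrow> real^'n^'m \<Rightarrow> (real^'m \<Rightarrow> real^'m) \<Rightarrow>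
    real set \<Rightarrow> (real \<Rightarrow> real^'n) \<Rightarrow> bool" where
  "nominal_solution_on A B C \<phi> J x \<longleftrightarrow>
    (\<forall>t\<in>J. (x has_vector_derivative nominal_field A B C \<phi> (x t)) (at t within J))"

definition quad_form :: "real^'n^'n \<Rightarrow> real^'n \<Rightarrow> real" where
  "quad_form P x = x \<bullet> (P *v x)"

definition sym_pos_def :: "real^'n^'n \<Rightarrow> bool" where
  "sym_pos_def P \<longleftrightarrow> transpose P = P \<and> (\<forall>x. x \<noteq> 0 \<longrightarrow> quad_form P x > 0)"

definition W_dot ::
  "real^'n^'n \<Rightarrow> real^'m^'n \<Rightarrow> real^'n^'m \<Rightarrow> (real^'m \<Rightarrow> real^'m) \<Rightarrow> real^'n^'n \<Rightarrow>
    real^'n \<Rightarrow> real" where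
  "W_dot A B C \<phi> P x = 2 * (x \<bullet> (P *v nominal_field A B C \<phi> x))"

(* The order on vectors is the componentwise one. *)
definition polytope_P :: "real^'n^'m \<Rightarrow> real^'m \<Rightarrow> real^'m \<Rightarrow> (real^'n) set" where
  "polytope_P C ylo yhi = {x. ylo \<le> C *v x \<and> C *v x \<le> yhi}"

(* A union of whole hyperplanes, not only of the facets of polytope_P. *)
definition bounding_hyperplanes :: "real^'n^'m \<Rightarrow> real^'m \<Rightarrow> real^'m \<Rightarrow> (real^'n) set" where
  "bounding_hyperplanes C ylo yhi =
    {x. \<exists>i. row i C \<bullet> x = ylo $ i \<or> row i C \<bullet> x = yhi $ i}"

(* LEAST is the minimum of the set of values, which is attained when P is positive definite
   and the rows of C are nonzero. *)
definition W_min :: "real^'n^'n \<Rightarrow> real^'n^'m \<Rightarrow> real^'m \<Rightarrow> real^'m \<Rightarrow> real" where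
  "W_min P C ylo yhi = (LEAST w. w \<in> quad_form P ` bounding_hyperplanes C ylo yhi)"

definition Omega :: "real^'n^'n \<Rightarrow> real^'n^'m \<Rightarrow> real^'m \<Rightarrow> real^'m \<Rightarrow> (real^'n) set" where
  "Omega P C ylo yhi = {x \<in> polytope_P C ylo yhi. quad_form P x \<le> W_min P C ylo yhi}"

end

theory Submission
  imports Defs
begin

text \<open>
  The key geometric fact is that \<^term>\<open>Omega P C ylo yhi\<close> is a whole ellipsoid, namely the sublevel
  set of \<open>W\<close> at level \<open>W_min\<close> (\<open>Omega_eq_sublevel\<close>): a point of the sublevel set outside the
  polytope could be shrunk towards the origin until it meets a bounding hyperplane, at a point
  where \<open>W\<close> would be smaller than its minimum on these hyperplanes. Being an ellipsoid, the region
  is compact and convex, and at each boundary point \<open>W\<close> strictly decreases along the flow, so that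
  no solution can leave (\<open>sublevel_invariant\<close>).

  Existence for all time needs no continuation argument. On the compact region the field is
  Lipschitz, and composing it with the nearest-point projection onto the convex region gives a
  globally Lipschitz field, which has a global solution by Banach's fixed point theorem
  (\<open>lipschitz_global_solution\<close>). The invariance argument evaluates the field only at boundary points
  of the region, where both fields agree; hence it traps the solution of the modified equation,
  which is therefore a solution of the nominal system. The same argument traps every other
  solution of the nominal system with this initial state, so uniqueness reduces to Gronwall's
  inequality with one Lipschitz constant (\<open>lipschitz_solution_unique\<close>).

  For convergence, \<open>W_dot\<close> attains a negative maximum on each compact set where \<open>W\<close> lies between
  \<open>e > 0\<close> and \<open>W_min\<close>. So \<open>W\<close> falls below every \<open>e\<close> and tends to \<open>0\<close>
  (\<open>uniform_decrease_tendsto_0\<close>), and \<open>W\<close> dominates a multiple of the squared norm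
  (\<open>quad_form_coercive\<close>).
\<close>

section \<open>Global solutions of Lipschitz differential equations\<close>

text \<open>
  With the weight \<open>exp (- l * (t - a))\<close>, integration gains a factor \<open>1 / l\<close> uniformly in \<open>t\<close>. This
  one estimate yields both the boundedness and the contraction property of the Picard operator.
\<close>

lemma exp_weighted_integral_bound:
  fixes h :: "real \<Rightarrow> 'a::banach"
  assumes "a \<le> t" "0 < l" "0 \<le> K" "continuous_on {a..t} h"
    and bound: "\<And>s. s \<in> {a..t} \<Longrightarrow> norm (h s) \<le> K * exp (l * (s - a))"
  shows "exp (- l * (t - a)) * norm (integral {a..t} h) \<le> K / l"
proof -
  let ?E = "\<lambda>s. K / l * exp (l * (s - a))"
  have E: "((\<lambda>s. K * exp (l * (s - a))) has_integral (?E t - ?E a)) {a..t}"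
    by (rule fundamental_theorem_of_calculus[OF \<open>a \<le> t\<close>])
      (use \<open>0 < l\<close> in \<open>auto simp flip: has_real_derivative_iff_has_vector_derivative
         intro!: derivative_eq_intros\<close>)
  have "norm (integral {a..t} h) \<le> integral {a..t} (\<lambda>s. K * exp (l * (s - a)))"
    using assms(4) bound
    by (intro integral_norm_bound_integral integrable_continuous_real has_integral_integrable[OF E])
  also have "\<dots> = ?E t - ?E a"
    using E by (rule integral_unique)
  also have "\<dots> \<le> ?E t"
    using assms by simp
  finally have "exp (- l * (t - a)) * norm (integral {a..t} h) \<le> exp (- l * (t - a)) * ?E t"
    by (rule mult_left_mono) simp
  also have "\<dots> = K / l"
    by (simp add: exp_minus)
  finally show ?thesis .
qed

text \<open>
  The Picard operator is a contraction on the whole half line, without any gluing of local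
  solutions, once functions are measured in a norm with exponential weight (Bielecki's norm).
  The weight is divided out, so that the operator acts on bounded continuous functions \<open>u\<close>, which
  stand for the solution candidates \<open>exp (l * (t - a)) *\<^sub>R u t\<close>.
\<close>

lemma lipschitz_global_solution:
  fixes g :: "'a::banach \<Rightarrow> 'a"
  assumes lip: "L-lipschitz_on UNIV g"
  shows "\<exists>x. x a = x0 \<and> (\<forall>t\<ge>a. (x has_vector_derivative g (x t)) (at t within {a..}))"
proof -
  have L: "0 \<le> L" using lip by (rule lipschitz_on_nonneg)
  have Ln: "norm (g y - g z) \<le> L * norm (y - z)" for y z
    using lipschitz_onD[OF lip, of y z] by (simp add: dist_norm)
  \<comment> \<open>Any positive rate above \<open>L\<close> makes the contraction factor \<open>L / l\<close> smaller than \<open>1\<close>.\<close>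
  define l where "l = 2 * L + 1"
  have l: "0 < l" using L by (simp add: l_def)
  define G where "G u s = g (exp (l * (s - a)) *\<^sub>R apply_bcontfun u s)"
    for u :: "real \<Rightarrow>\<^sub>C 'a" and s :: real
  \<comment> \<open>Clamping \<open>t\<close> at \<open>a\<close> extends the operator continuously to all times, because the bounded
    continuous functions are defined on the whole real line.\<close>
  define F where "F u t = exp (- l * (max a t - a)) *\<^sub>R (x0 + integral {a..max a t} (G u))"
    for u t
  have gcont: "continuous_on S g" for S
    by (rule continuous_on_subset[OF lipschitz_on_continuous_on[OF lip]]) simp
  have Gcont: "continuous_on S (G u)" for u S
    unfolding G_def by (intro continuous_on_compose2[OF gcont[of UNIV]] continuous_intros) auto
  have Gint: "G u integrable_on {a..t}" for u t
    by (intro integrable_continuous_real Gcont)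
  have dG: "((\<lambda>t. integral {a..t} (G u)) has_vector_derivative G u t) (at t within {a..b})"
    if "t \<in> {a..b}" for u t b
    by (rule integral_has_vector_derivative[OF Gcont that])
  have Icont: "continuous_on {a..} (\<lambda>t. integral {a..t} (G u))" for u
    unfolding continuous_on_eq_continuous_within
  proof
    fix t assume "t \<in> {a..}"
    then have "continuous (at t within {a..t+1}) (\<lambda>t. integral {a..t} (G u))"
      by (intro has_vector_derivative_continuous[OF dG]) auto
    moreover have "at t within {a..t+1} = at t within {a..}"
      by (rule at_within_nhd[where S="{..<t+1}"]) auto
    ultimately show "continuous (at t within {a..}) (\<lambda>t. integral {a..t} (G u))"
      by simp
  qed
  have Fcont: "continuous_on UNIV (F u)" for u
    unfolding F_def
    by (intro continuous_intros continuous_on_compose2[OF Icont]) auto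
  have Fbounded: "norm (F u t) \<le> norm x0 + (norm (g 0) + L * norm u) / l" for u t
  proof -
    define \<tau> where "\<tau> = max a t"
    have \<tau>: "a \<le> \<tau>" by (simp add: \<tau>_def)
    have "norm (G u s) \<le> (norm (g 0) + L * norm u) * exp (l * (s - a))" if "s \<in> {a..\<tau>}" for s
    proof -
      have "norm (G u s) \<le> norm (g 0) + norm (G u s - g 0)"
        by norm
      also have "norm (G u s - g 0) \<le> L * (exp (l * (s - a)) * norm (u s))"
        using Ln[of "exp (l * (s - a)) *\<^sub>R u s" 0] by (simp add: G_def)
      also have "\<dots> \<le> L * (exp (l * (s - a)) * norm u)"
        using L by (intro mult_left_mono norm_bounded) auto
      also have "norm (g 0) \<le> norm (g 0) * exp (l * (s - a))"
        using that l by (simp add: mult_le_cancel_left1)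
      finally show ?thesis by (simp add: algebra_simps)
    qed
    then have "exp (- l * (\<tau> - a)) * norm (integral {a..\<tau>} (G u)) \<le> (norm (g 0) + L * norm u) / l"
      using L by (intro exp_weighted_integral_bound \<tau> l Gcont) auto
    moreover have "exp (- l * (\<tau> - a)) * norm x0 \<le> norm x0"
      using \<tau> l by (simp add: mult_left_le_one_le)
    moreover have "norm (F u t) = exp (- l * (\<tau> - a)) * norm (x0 + integral {a..\<tau>} (G u))"
      by (simp add: F_def \<tau>_def)
    moreover have "\<dots> \<le> exp (- l * (\<tau> - a)) * (norm x0 + norm (integral {a..\<tau>} (G u)))"
      by (intro mult_left_mono norm_triangle_ineq) simp
    ultimately show ?thesis by (simp only: distrib_left)
  qed
  define T where "T u = Bcontfun (F u)" for u
  have T: "apply_bcontfun (T u) = F u" for u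
    unfolding T_def by (rule Bcontfun_inverse, rule bcontfun_normI[OF Fcont Fbounded])
  have contr: "dist (T u) (T v) \<le> L / l * dist u v" for u v
  proof (rule dist_bound)
    fix t
    define \<tau> where "\<tau> = max a t"
    have \<tau>: "a \<le> \<tau>" by (simp add: \<tau>_def)
    have *: "norm (G u s - G v s) \<le> (L * dist u v) * exp (l * (s - a))" for s
    proof -
      have "norm (G u s - G v s) \<le> L * (exp (l * (s - a)) * dist (u s) (v s))"
        using Ln[of "exp (l * (s - a)) *\<^sub>R u s" "exp (l * (s - a)) *\<^sub>R v s"]
        by (simp add: G_def dist_norm flip: scaleR_diff_right)
      also have "\<dots> \<le> L * (exp (l * (s - a)) * dist u v)"
        using L by (intro mult_left_mono dist_bounded) auto
      finally show ?thesis by (simp add: algebra_simps)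
    qed
    have "F u t - F v t = exp (- l * (\<tau> - a)) *\<^sub>R integral {a..\<tau>} (\<lambda>s. G u s - G v s)"
      unfolding F_def \<tau>_def[symmetric]
      by (simp add: integral_diff[OF Gint Gint] algebra_simps)
    then have "dist (T u t) (T v t) =
        exp (- l * (\<tau> - a)) * norm (integral {a..\<tau>} (\<lambda>s. G u s - G v s))"
      by (simp add: T dist_norm)
    also have "\<dots> \<le> L * dist u v / l"
      using L by (intro exp_weighted_integral_bound \<tau> l * continuous_intros Gcont) auto
    finally show "dist (T u t) (T v t) \<le> L / l * dist u v" by simp
  qed
  have "\<exists>!u. T u = u"
    using L l contr by (intro banach_fix_type[of "L / l"]) (auto simp: l_def)
  then obtain u where "T u = u" by blast
  then have u: "apply_bcontfun u t = F u t" for t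
    using T[of u] by simp
  define x where "x t = exp (l * (t - a)) *\<^sub>R apply_bcontfun u t" for t
  have xI: "x t = x0 + integral {a..t} (G u)" if "a \<le> t" for t
    using that unfolding x_def u F_def by (simp add: max_def flip: exp_add)
  have "(x has_vector_derivative g (x t)) (at t within {a..})" if t: "a \<le> t" for t
  proof -
    have "((\<lambda>t. x0 + integral {a..t} (G u)) has_vector_derivative g (x t)) (at t within {a..t+1})"
      using dG[of t "t + 1" u] t
      by (auto intro!: derivative_eq_intros simp: G_def x_def)
    then have "(x has_vector_derivative g (x t)) (at t within {a..t+1})"
      by (rule has_vector_derivative_transform[rotated 2]) (use t xI in auto)
    moreover have "at t within {a..t+1} = at t within {a..}"
      by (rule at_within_nhd[where S="{..<t+1}"]) (use t in auto)
    ultimately show ?thesis by simp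
  qed
  moreover have "x a = x0" using xI[of a] by simp
  ultimately show ?thesis by blast
qed

section \<open>Scalar comparison arguments\<close>

text \<open>
  If the level \<open>c\<close> were exceeded, there would be a last earlier time at which \<open>V\<close> is at most \<open>c\<close>;
  there \<open>V\<close> equals \<open>c\<close> and decreases strictly to the right, contradicting that it is the last. Only
  the derivative on the level set itself matters, so the field may be altered elsewhere.
\<close>

lemma sublevel_invariant:
  fixes V :: "real \<Rightarrow> real"
  assumes J: "is_interval J" "a \<in> J" "t \<in> J" "a \<le> t"
    and cont: "continuous_on J V" and init: "V a \<le> c"
    and dec: "\<And>s. s \<in> J \<Longrightarrow> V s = c \<Longrightarrow> \<exists>D<0. (V has_real_derivative D) (at s within J)"
  shows "V t \<le> c"
proof (rule ccontr)
  assume "\<not> V t \<le> c"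
  have sub: "{a..t} \<subseteq> J"
    using mem_is_interval_1_I[OF J(1-3)] by auto
  have cont': "continuous_on {a..t} V"
    using cont sub by (rule continuous_on_subset)
  define S where "S = {s \<in> {a..t}. V s \<in> {..c}}"
  have "closed S"
    using continuous_closed_preimage[OF cont', of "{..c}"] by (simp add: S_def vimage_def Int_def)
  moreover have "bounded S"
    by (rule bounded_subset[OF bounded_closed_interval[of a t]]) (auto simp: S_def)
  ultimately have "compact S"
    by (simp add: compact_eq_bounded_closed)
  moreover have "S \<noteq> {}"
    using init \<open>a \<le> t\<close> by (auto simp: S_def)
  ultimately obtain s0 where s0: "s0 \<in> S" and max: "\<And>s. s \<in> S \<Longrightarrow> s \<le> s0"
    using compact_attains_sup by metis
  have s0t: "a \<le> s0" "s0 < t" and "V s0 \<le> c"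
    using s0 \<open>\<not> V t \<le> c\<close> by (auto simp: S_def order_less_le)
  have "\<exists>s\<ge>s0. s \<le> t \<and> V s = c"
    using \<open>V s0 \<le> c\<close> \<open>\<not> V t \<le> c\<close> s0t
    by (intro IVT' continuous_on_subset[OF cont']) auto
  then obtain s where s: "s0 \<le> s" "s \<le> t" "V s = c" by blast
  then have "s \<in> S" using s0t by (simp add: S_def)
  then have "s = s0" using max s(1) by (intro antisym)
  then have "V s0 = c" using s(3) by simp
  moreover have "s0 \<in> J"
    using s0t sub by auto
  ultimately obtain D where "D < 0" "(V has_real_derivative D) (at s0 within J)"
    using dec by blast
  then obtain d where d: "d > 0" "\<And>h. \<lbrakk>h > 0; s0 + h \<in> J; h < d\<rbrakk> \<Longrightarrow> V (s0 + h) < V s0"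
    using has_real_derivative_neg_dec_right by blast
  define h where "h = min (d / 2) (t - s0)"
  have h: "0 < h" "h < d" "s0 + h \<in> {a..t}"
    using d(1) s0t by (auto simp: h_def)
  then have "s0 + h \<in> S"
    using d(2)[of h] sub \<open>V s0 = c\<close> by (force simp: S_def)
  then show False
    using max[of "s0 + h"] h by simp
qed

lemma derivative_le_imp_decrease:
  fixes V :: "real \<Rightarrow> real"
  assumes "a \<le> t"
    and der: "\<And>s. s \<in> {a..t} \<Longrightarrow> (V has_real_derivative D s) (at s within {a..t})"
    and le: "\<And>s. s \<in> {a..t} \<Longrightarrow> D s \<le> - d"
  shows "V t \<le> V a - d * (t - a)"
proof (cases "a = t")
  case False
  then have "a < t" using \<open>a \<le> t\<close> by simp
  then have "\<exists>s\<in>{a<..<t}. V t - V a = D s * (t - a)"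
    by (rule mvt_simple) (use der in \<open>auto simp: has_field_derivative_def\<close>)
  then obtain s where s: "s \<in> {a<..<t}" "V t - V a = D s * (t - a)" ..
  moreover have "D s * (t - a) \<le> - d * (t - a)"
    using s le \<open>a < t\<close> by (intro mult_right_mono) auto
  ultimately show ?thesis by simp
qed simp

text \<open>
  The rate \<open>d\<close> may depend on \<open>e\<close>: it is used only to bring \<open>V\<close> below \<open>e\<close> once, after which
  monotonicity keeps it there.
\<close>

lemma uniform_decrease_tendsto_0:
  fixes V :: "real \<Rightarrow> real"
  assumes der: "\<And>t. a \<le> t \<Longrightarrow> (V has_real_derivative D t) (at t within {a..})"
    and nonneg: "\<And>t. a \<le> t \<Longrightarrow> 0 \<le> V t"
    and nonpos: "\<And>t. a \<le> t \<Longrightarrow> D t \<le> 0"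
    and gap: "\<And>e. 0 < e \<Longrightarrow> \<exists>d>0. \<forall>t\<ge>a. e \<le> V t \<longrightarrow> D t \<le> - d"
  shows "(V \<longlongrightarrow> 0) at_top"
proof (rule tendstoI)
  fix e :: real assume "0 < e"
  then obtain d where d: "0 < d" "\<And>t. \<lbrakk>a \<le> t; e \<le> V t\<rbrakk> \<Longrightarrow> D t \<le> - d"
    using gap by blast
  have der': "(V has_real_derivative D s) (at s within {r..t})" if "a \<le> r" "s \<in> {r..t}" for r s t
    by (rule DERIV_subset[OF der]) (use that in auto)
  have "\<exists>r\<ge>a. V r < e"
  proof (rule ccontr)
    assume "\<not> ?thesis"
    then have ge: "e \<le> V t" if "a \<le> t" for t
      using that by force
    \<comment> \<open>By this time, decrease at rate \<open>d\<close> would have used up the initial value.\<close>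
    define t where "t = a + V a / d"
    have "a \<le> t" using nonneg[of a] d by (simp add: t_def)
    then have "V t \<le> V a - d * (t - a)"
    proof (rule derivative_le_imp_decrease)
      fix s assume s: "s \<in> {a..t}"
      show "(V has_real_derivative D s) (at s within {a..t})"
        using s by (intro der') auto
      show "D s \<le> - d"
        using s ge by (intro d(2)) auto
    qed
    also have "\<dots> = 0" using d by (simp add: t_def)
    finally show False using ge[OF \<open>a \<le> t\<close>] \<open>0 < e\<close> by simp
  qed
  then obtain r where r: "a \<le> r" "V r < e" by blast
  have "dist (V t) 0 < e" if "r \<le> t" for t
  proof -
    have "V t \<le> V r - 0 * (t - r)"
    proof (rule derivative_le_imp_decrease[OF that])
      fix s assume s: "s \<in> {r..t}"
      show "(V has_real_derivative D s) (at s within {r..t})"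
        using s r by (intro der') auto
      show "D s \<le> - 0"
        using s r nonpos[of s] by simp
    qed
    then show ?thesis using r nonneg[of t] that by simp
  qed
  then show "eventually (\<lambda>t. dist (V t) 0 < e) at_top"
    unfolding eventually_at_top_linorder by blast
qed

text \<open>
  This is Gronwall's argument: the squared distance of the two solutions grows at most at the
  exponential rate \<open>2 * L\<close>, so multiplied by \<open>exp (- (2 * L) * (s - a))\<close> it does not increase.
\<close>

lemma lipschitz_solution_unique:
  fixes x y :: "real \<Rightarrow> 'a::real_inner"
  assumes J: "is_interval J" "a \<in> J" "t \<in> J" "a \<le> t"
    and lip: "L-lipschitz_on K g"
    and x: "\<And>s. s \<in> J \<Longrightarrow> x s \<in> K \<and> (x has_vector_derivative g (x s)) (at s within J)"
    and y: "\<And>s. s \<in> J \<Longrightarrow> y s \<in> K \<and> (y has_vector_derivative g (y s)) (at s within J)"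
    and init: "x a = y a"
  shows "x t = y t"
proof -
  have sub: "{a..t} \<subseteq> J"
    using mem_is_interval_1_I[OF J(1-3)] by auto
  define N where "N s = (x s - y s) \<bullet> (x s - y s)" for s
  define N' where "N' s = 2 * ((x s - y s) \<bullet> (g (x s) - g (y s)))" for s
  define E where "E s = exp (- (2 * L) * (s - a)) * N s" for s
  define E' where "E' s = exp (- (2 * L) * (s - a)) * (N' s - 2 * L * N s)" for s
  have "(N has_real_derivative N' s) (at s within {a..t})" if "s \<in> {a..t}" for s
  proof -
    have "((\<lambda>s. x s - y s) has_vector_derivative g (x s) - g (y s)) (at s within {a..t})"
      by (rule has_vector_derivative_within_subset[OF has_vector_derivative_diff sub])
        (use that sub x y in auto)
    from bounded_bilinear.has_vector_derivative[OF bounded_bilinear_inner this this]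
    show ?thesis
      unfolding has_real_derivative_iff_has_vector_derivative N_def N'_def
      by (simp add: inner_commute)
  qed
  then have E: "(E has_real_derivative E' s) (at s within {a..t})" if "s \<in> {a..t}" for s
    unfolding E_def E'_def using that
    by (auto intro!: derivative_eq_intros simp: algebra_simps)
  have "E' s \<le> - 0" if "s \<in> {a..t}" for s
  proof -
    have "(x s - y s) \<bullet> (g (x s) - g (y s)) \<le> norm (x s - y s) * norm (g (x s) - g (y s))"
      by (rule norm_cauchy_schwarz)
    also have "\<dots> \<le> norm (x s - y s) * (L * norm (x s - y s))"
      using lipschitz_on_normD[OF lip] x y that sub by (intro mult_left_mono) auto
    also have "\<dots> = L * N s"
      by (simp add: N_def dot_square_norm power2_eq_square)
    finally have "N' s - 2 * L * N s \<le> 0" by (simp add: N'_def)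
    then show ?thesis by (simp add: E'_def mult_nonneg_nonpos)
  qed
  with E have "E t \<le> E a - 0 * (t - a)"
    using derivative_le_imp_decrease[OF \<open>a \<le> t\<close>, of E E' 0] by blast
  also have "\<dots> = 0"
    using init by (simp add: E_def N_def)
  finally have "N t \<le> 0"
    by (simp add: E_def mult_le_0_iff)
  then show ?thesis
    using inner_gt_zero_iff[of "x t - y t"] by (fastforce simp: N_def)
qed

section \<open>Positive definite quadratic forms\<close>

lemma quad_form_scaleR: "quad_form P (s *\<^sub>R x) = s\<^sup>2 * quad_form P x"
  by (simp add: quad_form_def power2_eq_square matrix_vector_mult_scaleR)

lemma quad_form_0 [simp]: "quad_form P 0 = 0"
  by (simp add: quad_form_def)

lemma quad_form_nonneg: "sym_pos_def P \<Longrightarrow> 0 \<le> quad_form P x"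
  unfolding sym_pos_def_def by (cases "x = 0") (auto intro: less_imp_le)

lemma inner_matrix_symmetric:
  fixes P :: "real^'n^'n"
  assumes "transpose P = P"
  shows "x \<bullet> (P *v y) = y \<bullet> (P *v x)"
  using assms by (metis dot_lmul_matrix inner_commute transpose_matrix_vector)

lemma continuous_on_matrix_vector_mult [continuous_intros]:
  fixes M :: "real^'n^'m"
  shows "continuous_on S f \<Longrightarrow> continuous_on S (\<lambda>x. M *v f x)"
  by (rule bounded_linear.continuous_on[OF matrix_vector_mul_bounded_linear])

lemma continuous_on_quad_form: "continuous_on S (quad_form P)"
proof -
  have "continuous_on S (\<lambda>x. x \<bullet> (P *v x))"
    by (intro continuous_intros)
  then show ?thesis
    by (simp add: quad_form_def[abs_def])
qed

text \<open>By homogeneity, the minimum of the form on the unit sphere serves as the constant.\<close>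

lemma quad_form_coercive:
  fixes P :: "real^'n^'n"
  assumes P: "sym_pos_def P"
  shows "\<exists>m>0. \<forall>x. m * (norm x)\<^sup>2 \<le> quad_form P x"
proof -
  have "sphere (0::real^'n) 1 \<noteq> {}"
    using norm_axis_1 by (metis empty_iff mem_sphere_0)
  then obtain u where u: "norm u = 1" "\<And>v. norm v = 1 \<Longrightarrow> quad_form P u \<le> quad_form P v"
    using continuous_attains_inf[OF compact_sphere _ continuous_on_quad_form, of 0 1 P]
    by (auto simp: mem_sphere_0)
  have "0 < quad_form P u"
    using P u(1) norm_zero[where 'a = "real^'n"] unfolding sym_pos_def_def by (metis zero_neq_one)
  moreover have "quad_form P u * (norm x)\<^sup>2 \<le> quad_form P x" for x
  proof (cases "x = 0")
    case False
    have "quad_form P u \<le> quad_form P ((1 / norm x) *\<^sub>R x)"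
      using False by (intro u(2)) simp
    also have "\<dots> = quad_form P x / (norm x)\<^sup>2"
      by (simp add: quad_form_scaleR power_divide)
    finally show ?thesis using False by (simp add: field_simps)
  qed simp
  ultimately show ?thesis by blast
qed

lemma compact_quad_form_sublevel:
  assumes "sym_pos_def P" "closed S"
  shows "compact {x \<in> S. quad_form P x \<le> c}"
proof -
  obtain m where m: "0 < m" "\<And>x. m * (norm x)\<^sup>2 \<le> quad_form P x"
    using quad_form_coercive[OF assms(1)] by blast
  have "norm x \<le> sqrt (c / m)" if "quad_form P x \<le> c" for x
  proof (rule real_le_rsqrt)
    have "m * (norm x)\<^sup>2 \<le> c" using m(2)[of x] that by simp
    then show "(norm x)\<^sup>2 \<le> c / m" using m(1) by (simp add: field_simps)
  qed
  then have "bounded {x \<in> S. quad_form P x \<le> c}"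
    unfolding bounded_iff by blast
  moreover have "closed (S \<inter> quad_form P -` {..c})"
    by (intro continuous_closed_preimage continuous_on_quad_form assms closed_atMost)
  then have "closed {x \<in> S. quad_form P x \<le> c}"
    by (simp add: vimage_def Int_def)
  ultimately show ?thesis by (simp add: compact_eq_bounded_closed)
qed

text \<open>
  For weights \<open>u + v = 1\<close>, the form at \<open>u *\<^sub>R x + v *\<^sub>R y\<close> is the weighted mean of its values at \<open>x\<close>
  and \<open>y\<close> minus \<open>u * v * quad_form P (x - y)\<close>, and the last term is nonnegative.
\<close>

lemma convex_quad_form_sublevel:
  assumes P: "sym_pos_def P"
  shows "convex {x. quad_form P x \<le> c}"
proof (rule convexI)
  fix x y and u v :: real
  assume xy: "x \<in> {x. quad_form P x \<le> c}" "y \<in> {x. quad_form P x \<le> c}"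
    and uv: "0 \<le> u" "0 \<le> v" "u + v = 1"
  have sym: "y \<bullet> (P *v x) = x \<bullet> (P *v y)"
    using P by (intro inner_matrix_symmetric) (simp add: sym_pos_def_def)
  have "quad_form P (u *\<^sub>R x + v *\<^sub>R y) =
      u\<^sup>2 * quad_form P x + v\<^sup>2 * quad_form P y + 2 * u * v * (x \<bullet> (P *v y))"
    by (simp add: quad_form_def matrix_vector_right_distrib matrix_vector_mult_scaleR
        inner_add_left inner_add_right sym power2_eq_square algebra_simps)
  also have "2 * u * v * (x \<bullet> (P *v y)) =
      u * v * (quad_form P x + quad_form P y - quad_form P (x - y))"
    by (simp add: quad_form_def matrix_vector_mult_diff_distrib
        inner_diff_left inner_diff_right sym algebra_simps)
  also have "\<dots> \<le> u * v * (quad_form P x + quad_form P y)"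
    using uv quad_form_nonneg[OF P, of "x - y"] by (intro mult_left_mono) auto
  also have "u\<^sup>2 * quad_form P x + v\<^sup>2 * quad_form P y + u * v * (quad_form P x + quad_form P y) =
      (u + v) * (u * quad_form P x + v * quad_form P y)"
    by (simp add: power2_eq_square algebra_simps)
  also have "\<dots> \<le> u * c + v * c"
    using uv xy by (simp add: add_mono mult_left_mono)
  also have "\<dots> = c"
    using uv by (simp flip: distrib_right)
  finally show "u *\<^sub>R x + v *\<^sub>R y \<in> {x. quad_form P x \<le> c}"
    by simp
qed

lemma quad_form_derivative:
  fixes P :: "real^'n^'n"
  assumes P: "transpose P = P" and x: "(x has_vector_derivative v) (at t within J)"
  shows "((\<lambda>s. quad_form P (x s)) has_real_derivative 2 * (x t \<bullet> (P *v v))) (at t within J)"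
proof -
  have "((\<lambda>s. P *v x s) has_vector_derivative P *v v) (at t within J)"
    by (rule bounded_linear.has_vector_derivative[OF matrix_vector_mul_bounded_linear x])
  from bounded_bilinear.has_vector_derivative[OF bounded_bilinear_inner x this]
  show ?thesis
    unfolding quad_form_def has_real_derivative_iff_has_vector_derivative
    by (simp add: inner_matrix_symmetric[OF P, of v])
qed

section \<open>The region as an ellipsoid\<close>

lemma matrix_vector_mult_nth: "(C *v x) $ i = row i C \<bullet> x"
  by (simp add: matrix_vector_mul_component row_def)

text \<open>
  The hyperplanes form a closed set, nonempty because the rows of \<open>C\<close> do not vanish, and its part
  below any given level of the form is compact. So the \<open>LEAST\<close> in the definition of \<open>W_min\<close>, which
  is unspecified for a set of reals without a least element, is a true minimum.
\<close>

lemma W_min_attained: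
  fixes P :: "real^'n^'n" and C :: "real^'n^'m"
  assumes C: "\<And>i. row i C \<noteq> 0" and P: "sym_pos_def P"
  shows "\<exists>x\<in>bounding_hyperplanes C ylo yhi. quad_form P x = W_min P C ylo yhi"
    and "\<And>x. x \<in> bounding_hyperplanes C ylo yhi \<Longrightarrow> W_min P C ylo yhi \<le> quad_form P x"
proof -
  let ?H = "bounding_hyperplanes C ylo yhi"
  have "?H = (\<Union>i. {x. row i C \<bullet> x = ylo $ i} \<union> {x. row i C \<bullet> x = yhi $ i})"
    by (auto simp: bounding_hyperplanes_def)
  then have "closed ?H"
    by (auto intro!: closed_Union closed_hyperplane)
  obtain i :: 'm where True by simp
  have "(ylo $ i / (row i C \<bullet> row i C)) *\<^sub>R row i C \<in> ?H"
    using C[of i] by (auto simp: bounding_hyperplanes_def intro!: exI[of _ i])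
  then obtain z where z: "z \<in> ?H" by blast
  let ?K = "{x \<in> ?H. quad_form P x \<le> quad_form P z}"
  have "compact ?K" by (rule compact_quad_form_sublevel[OF P \<open>closed ?H\<close>])
  have "?K \<noteq> {}" using z by auto
  obtain x where x: "x \<in> ?K" "\<And>y. y \<in> ?K \<Longrightarrow> quad_form P x \<le> quad_form P y"
    using continuous_attains_inf[OF \<open>compact ?K\<close> \<open>?K \<noteq> {}\<close>
        continuous_on_quad_form[where P = P]] by (elim bexE) simp
  have le: "quad_form P x \<le> quad_form P y" if "y \<in> ?H" for y
    using x that by (cases "quad_form P y \<le> quad_form P z") auto
  have "W_min P C ylo yhi = quad_form P x"
    unfolding W_min_def using x(1) le by (intro Least_equality) auto
  with x(1) le show "\<exists>x\<in>?H. quad_form P x = W_min P C ylo yhi"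
    and "\<And>x. x \<in> ?H \<Longrightarrow> W_min P C ylo yhi \<le> quad_form P x"
    by auto
qed

lemma W_min_pos:
  fixes P :: "real^'n^'n" and C :: "real^'n^'m"
  assumes C: "\<And>i. row i C \<noteq> 0" and P: "sym_pos_def P"
    and y: "\<And>i. ylo $ i < 0 \<and> 0 < yhi $ i"
  shows "0 < W_min P C ylo yhi"
proof -
  obtain x where x: "x \<in> bounding_hyperplanes C ylo yhi" "quad_form P x = W_min P C ylo yhi"
    using W_min_attained(1)[OF C P] by blast
  have "x \<noteq> 0"
  proof
    assume "x = 0"
    then obtain i where "ylo $ i = 0 \<or> yhi $ i = 0"
      using x(1) by (auto simp: bounding_hyperplanes_def)
    then show False using y[of i] by auto
  qed
  then show ?thesis
    using P x(2) by (auto simp: sym_pos_def_def)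
qed

lemma Omega_eq_sublevel:
  fixes P :: "real^'n^'n" and C :: "real^'n^'m"
  assumes C: "\<And>i. row i C \<noteq> 0" and P: "sym_pos_def P"
    and y: "\<And>i. ylo $ i < 0 \<and> 0 < yhi $ i"
  shows "Omega P C ylo yhi = {x. quad_form P x \<le> W_min P C ylo yhi}"
proof -
  have "ylo $ i \<le> row i C \<bullet> x \<and> row i C \<bullet> x \<le> yhi $ i"
    if x: "quad_form P x \<le> W_min P C ylo yhi" for x i
  proof -
    \<comment> \<open>Outside the polytope, some \<open>s *\<^sub>R x\<close> with \<open>0 < s < 1\<close> lies on a bounding hyperplane, while
      its value \<open>s\<^sup>2 * quad_form P x\<close> is below the minimum there.\<close>
    have shrink: False
      if "0 < s" "s < 1" "s * (row i C \<bullet> x) \<in> {ylo $ i, yhi $ i}" for s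
    proof -
      have "s *\<^sub>R x \<in> bounding_hyperplanes C ylo yhi"
        using that(3) unfolding bounding_hyperplanes_def by (simp, intro exI[of _ i])
      then have le: "W_min P C ylo yhi \<le> s\<^sup>2 * quad_form P x"
        using W_min_attained(2)[OF C P, of "s *\<^sub>R x"] by (simp add: quad_form_scaleR)
      have "x \<noteq> 0"
        using that(3) y[of i] by auto
      then have "0 < quad_form P x" using P by (auto simp: sym_pos_def_def)
      then have "s\<^sup>2 * quad_form P x < quad_form P x"
        using that abs_square_less_1[of s] mult_strict_right_mono[of "s\<^sup>2" 1] by simp
      then show False using x le by simp
    qed
    show ?thesis
    proof (intro conjI; rule ccontr)
      assume "\<not> ylo $ i \<le> row i C \<bullet> x"
      then show False
        using shrink[of "ylo $ i / (row i C \<bullet> x)"] y[of i] by (simp add: field_simps)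
    next
      assume "\<not> row i C \<bullet> x \<le> yhi $ i"
      then show False
        using shrink[of "yhi $ i / (row i C \<bullet> x)"] y[of i] by (simp add: field_simps)
    qed
  qed
  then show ?thesis
    by (auto simp: Omega_def polytope_P_def less_eq_vec_def matrix_vector_mult_nth)
qed

section \<open>The nominal system\<close>

lemma nominal_field_lipschitz_on_compact:
  fixes A :: "real^'n^'n" and B :: "real^'m^'n" and C :: "real^'n^'m"
  assumes lip: "local_lipschitz (UNIV :: real set) UNIV (\<lambda>_. \<phi>)" and "compact K"
  shows "\<exists>L. L-lipschitz_on K (nominal_field A B C \<phi>)"
proof -
  note bl = bounded_linear.lipschitz_boundE[OF matrix_vector_mul_bounded_linear]
  let ?Y = "(*v) C ` K"
  have "compact ?Y"
    by (intro compact_continuous_image continuous_intros \<open>compact K\<close>)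
  moreover have "local_lipschitz {0::real} ?Y (\<lambda>_. \<phi>)"
    by (rule local_lipschitz_subset[OF lip]) auto
  ultimately obtain L where L: "L-lipschitz_on ?Y \<phi>"
    using local_lipschitz_compact_implies_lipschitz[where X = ?Y and T = "{0::real}"
        and f = "\<lambda>_. \<phi>"] by auto
  obtain a b c where "a-lipschitz_on K ((*v) A)" "c-lipschitz_on K ((*v) C)"
      "b-lipschitz_on ((\<lambda>x. \<phi> (C *v x)) ` K) ((*v) B)"
    using bl by metis
  with L have "(a + b * (L * c))-lipschitz_on K (\<lambda>x. A *v x + B *v \<phi> (C *v x))"
    by (intro lipschitz_on_add lipschitz_on_compose2[of _ _ "\<lambda>x. \<phi> (C *v x)"]
        lipschitz_on_compose2[of _ _ "(*v) C" _ \<phi>])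
  then show ?thesis
    unfolding nominal_field_def[abs_def] by blast
qed

theorem mainTheorem1:
  fixes A :: "real^'n^'n" and B :: "real^'m^'n" and C :: "real^'n^'m"
    and \<phi> :: "real^'m \<Rightarrow> real^'m" and ylo yhi :: "real^'m"
    and P :: "real^'n^'n" and tc :: real and x0 :: "real^'n"
  assumes "\<And>i. row i C \<noteq> 0"
    and "local_lipschitz (UNIV :: real set) UNIV (\<lambda>_. \<phi>)"
    and "\<phi> 0 = 0"
    and "\<And>i. ylo $ i < 0 \<and> 0 < yhi $ i"
    and "sym_pos_def P"
    and "\<And>x. x \<in> polytope_P C ylo yhi - {0} \<Longrightarrow> W_dot A B C \<phi> P x < 0"
    and "x0 \<in> Omega P C ylo yhi"
  shows "\<exists>x. nominal_solution_on A B C \<phi> {tc..} x \<and> x tc = x0 \<and>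
      (\<forall>J y. is_interval J \<and> tc \<in> J \<and> J \<subseteq> {tc..} \<and>
          nominal_solution_on A B C \<phi> J y \<and> y tc = x0 \<longrightarrow> (\<forall>t\<in>J. y t = x t)) \<and>
      (\<forall>t\<ge>tc. x t \<in> Omega P C ylo yhi) \<and>
      (x \<longlongrightarrow> 0) at_top"
proof -
  let ?f = "nominal_field A B C \<phi>"
  let ?W = "quad_form P"
  let ?D = "W_dot A B C \<phi> P"
  define c where "c = W_min P C ylo yhi"
  define K where "K = Omega P C ylo yhi"
  have sym: "transpose P = P"
    using assms(5) by (simp add: sym_pos_def_def)
  have c: "0 < c"
    unfolding c_def by (rule W_min_pos[OF assms(1,5,4)])
  have K: "K = {x. ?W x \<le> c}"
    unfolding K_def c_def by (rule Omega_eq_sublevel[OF assms(1,5,4)])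
  have Wdot_neg: "?D x < 0" if "x \<in> K" "x \<noteq> 0" for x
    using that assms(6) by (simp add: K_def Omega_def)
  have "compact K"
    using compact_quad_form_sublevel[OF assms(5) closed_UNIV] by (simp add: K)
  have "convex K"
    using convex_quad_form_sublevel[OF assms(5)] by (simp add: K)
  have "closed K" "K \<noteq> {}"
    using \<open>compact K\<close> assms(7) by (auto simp: compact_imp_closed K_def)
  obtain L where L: "L-lipschitz_on K ?f"
    using nominal_field_lipschitz_on_compact[OF assms(2) \<open>compact K\<close>] by blast

  \<comment> \<open>Stated for every field \<open>h\<close> agreeing with the nominal one on \<open>K\<close>: it is applied both to the
    projected field, for existence, and to the nominal field, for uniqueness.\<close>
  have invariant: "z t \<in> K"
    if "is_interval J" "tc \<in> J" "J \<subseteq> {tc..}" "t \<in> J" "z tc = x0"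
      and z: "\<And>s. s \<in> J \<Longrightarrow> (z has_vector_derivative h (z s)) (at s within J)"
      and h: "\<And>x. x \<in> K \<Longrightarrow> h x = ?f x"
    for J z t h
  proof -
    have W': "((\<lambda>s. ?W (z s)) has_real_derivative 2 * (z s \<bullet> (P *v h (z s)))) (at s within J)"
      if "s \<in> J" for s
      by (rule quad_form_derivative[OF sym z[OF that]])
    have "?W (z t) \<le> c"
    proof (rule sublevel_invariant[of J tc t "\<lambda>s. ?W (z s)"])
      show "continuous_on J (\<lambda>s. ?W (z s))"
        by (rule DERIV_continuous_on[OF W'])
      show "?W (z tc) \<le> c"
        using assms(7) \<open>z tc = x0\<close> K by (simp add: K_def)
      fix s assume s: "s \<in> J" "?W (z s) = c"
      then have "z s \<in> K" "z s \<noteq> 0"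
        using c by (auto simp: K)
      then have "2 * (z s \<bullet> (P *v h (z s))) < 0"
        using Wdot_neg h by (simp add: W_dot_def)
      then show "\<exists>D<0. ((\<lambda>s. ?W (z s)) has_real_derivative D) (at s within J)"
        using W'[OF s(1)] by blast
    qed (use that in auto)
    then show ?thesis by (simp add: K)
  qed

  define g where "g x = ?f (closest_point K x)" for x
  have g: "g x = ?f x" if "x \<in> K" for x
    using that by (simp add: g_def closest_point_self)
  have "1-lipschitz_on UNIV (closest_point K)"
    using closest_point_lipschitz[OF \<open>convex K\<close> \<open>closed K\<close> \<open>K \<noteq> {}\<close>]
    by (intro lipschitz_onI) auto
  moreover have "L-lipschitz_on (range (closest_point K)) ?f"
    using closest_point_in_set[OF \<open>closed K\<close> \<open>K \<noteq> {}\<close>]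
    by (intro lipschitz_on_subset[OF L]) auto
  ultimately have "(L * 1)-lipschitz_on UNIV g"
    unfolding g_def by (rule lipschitz_on_compose2)
  then obtain x where x0: "x tc = x0"
    and xg: "\<And>t. t \<ge> tc \<Longrightarrow> (x has_vector_derivative g (x t)) (at t within {tc..})"
    using lipschitz_global_solution by metis
  have xK: "x t \<in> K" if "t \<ge> tc" for t
    using that by (intro invariant[of "{tc..}" t x g] x0 xg g) (auto simp: is_interval_ci)
  have xf: "(x has_vector_derivative ?f (x t)) (at t within {tc..})" if "t \<ge> tc" for t
    using xg[OF that] g[OF xK[OF that]] by simp

  have unique: "y t = x t"
    if J: "is_interval J" "tc \<in> J" "J \<subseteq> {tc..}" "t \<in> J"
      and y: "nominal_solution_on A B C \<phi> J y" "y tc = x0" for J y t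
  proof (rule lipschitz_solution_unique[OF J(1,2,4) _ L])
    show "tc \<le> t" using J by auto
    show "y tc = x tc" using y x0 by simp
    fix s assume s: "s \<in> J"
    have yf: "(y has_vector_derivative ?f (y s)) (at s within J)" if "s \<in> J" for s
      using y that by (simp add: nominal_solution_on_def)
    show "y s \<in> K \<and> (y has_vector_derivative ?f (y s)) (at s within J)"
      using invariant[of J s y ?f] J y yf s by blast
    have "tc \<le> s" using s J(3) by auto
    then show "x s \<in> K \<and> (x has_vector_derivative ?f (x s)) (at s within J)"
      using xK has_vector_derivative_within_subset[OF xf J(3)] by blast
  qed

  have W0: "((\<lambda>t. ?W (x t)) \<longlongrightarrow> 0) at_top"
  proof (rule uniform_decrease_tendsto_0[where a = tc and V = "\<lambda>t. ?W (x t)" and D = "\<lambda>t. ?D (x t)"])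
    fix t assume t: "tc \<le> t"
    show "((\<lambda>t. ?W (x t)) has_real_derivative ?D (x t)) (at t within {tc..})"
      unfolding W_dot_def by (rule quad_form_derivative[OF sym xf[OF t]])
    show "0 \<le> ?W (x t)"
      by (rule quad_form_nonneg[OF assms(5)])
    show "?D (x t) \<le> 0"
      using Wdot_neg[OF xK[OF t]] by (cases "x t = 0") (auto simp: W_dot_def)
  next
    fix e :: real assume "0 < e"
    let ?R = "{x \<in> K. e \<le> ?W x}"
    have "closed {x. e \<le> ?W x}"
      by (intro closed_Collect_le continuous_on_quad_form continuous_on_const)
    then have "compact ?R"
      using compact_Int_closed[OF \<open>compact K\<close>, of "{x. e \<le> ?W x}"] by (simp add: Int_def)
    have D: "continuous_on ?R ?D"
      unfolding W_dot_def
      by (intro continuous_intros continuous_on_subset[OF lipschitz_on_continuous_on[OF L]]) auto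
    show "\<exists>d>0. \<forall>t\<ge>tc. e \<le> ?W (x t) \<longrightarrow> ?D (x t) \<le> - d"
    proof (cases "?R = {}")
      case True
      then show ?thesis using xK by (intro exI[of _ 1]) auto
    next
      case False
      then obtain p where p: "p \<in> ?R" "\<And>q. q \<in> ?R \<Longrightarrow> ?D q \<le> ?D p"
        using continuous_attains_sup[OF \<open>compact ?R\<close> _ D] by blast
      moreover have "p \<noteq> 0" using p(1) \<open>0 < e\<close> by auto
      ultimately show ?thesis
        using Wdot_neg[of p] xK by (intro exI[of _ "- ?D p"]) auto
    qed
  qed
  have "(x \<longlongrightarrow> 0) at_top"
  proof -
    obtain m where m: "0 < m" "\<And>x. m * (norm x)\<^sup>2 \<le> ?W x"
      using quad_form_coercive[OF assms(5)] by blast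
    have "((\<lambda>t. sqrt (?W (x t) / m)) \<longlongrightarrow> sqrt (0 / m)) at_top"
      using m(1) by (intro tendsto_intros W0) auto
    moreover have "norm (x t) \<le> sqrt (?W (x t) / m)" for t
      using m(1) m(2)[of "x t"] by (intro real_le_rsqrt) (simp add: field_simps)
    ultimately show ?thesis
      by (intro Lim_null_comparison[of x "\<lambda>t. sqrt (?W (x t) / m)"]) auto
  qed
  with xf x0 unique xK show ?thesis
    unfolding nominal_solution_on_def[of _ _ _ _ "{tc..}"] K_def[symmetric]
    by (intro exI[of _ x]) auto
qed

end
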